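(* (Discrete multisymplectic form formula.) Let $L:\mathcal{B}\to\mathbb{R}$ be a smooth discrete Lagrangian, let $U\subseteq X=\mathbb{Z}\times\mathbb{Z}$ be a finite regular subset, and let $\phi\in\mathcal{C}_U$ be a solution of the discrete Euler-Lagrange equations on $U$. Then for all vector fields $v,w$ on $Y$ such that $V=v\circ\phi$ and $W=w\circ\phi$ are first-variation equation solutions at $\phi$, $$\sum_{(i,j)\in\partial U}\left(\sum_{\square\subseteq U;\ l;\ (i,j)=\square^l}\big[(j^2\phi)^*(\mathbf{i}_{j^2w}\,\mathbf{i}_{j^2v}\,\Omega_L^l)\big](\square^1)\right)=0 .$$
   Context: $X=\mathbb{Z}\times\mathbb{Z}=\{(i,j)\}$, $Y=X\times\mathbb{R}$, with fiber $Y_{ij}\cong\mathbb{R}$ over $(i,j)$ and elements written $y_{ij}$. A rectangle is an ordered 4-tuple $\square_{ij}=((i,j),(i+1,j),(i+1,j+1),(i,j+1))$; its vertices in order are $\square^1,\square^2,\square^3,\square^4$; $X^\square$ is the set of all rectangles. A point is touched by a rectangle if it is one of its vertices. For $U\subseteq X$: $\square\subseteq U$ means all vertices of $\square$ lie in $U$; $(i,j)$ is an interior point of $U$ if $U$ contains all four rectangles touching $(i,j)$; $\mathrm{int}\,U$ is the set of interior points; $\mathrm{cl}\,U$ is the union of all rectangles touching interior points of $U$; $\partial U=(U\cap\mathrm{cl}\,U)\setminus\mathrm{int}\,U$; $U$ is regular if $U=\mathrm{int}\,U\cup\partial U$. $\mathcal{B}=X^\square\times\mathbb{R}^4$ is the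 discrete analogue of a subbundle of the second jet bundle, with elements $(\square;y_1,y_2,y_3,y_4)$. $\mathcal{C}_U\cong\mathbb{R}^{|U|}$ is the set of sections $\phi$ of $Y$ over $U$; $j^2\phi(i,j)=(\square_{ij},\phi(\square^1),\phi(\square^2),\phi(\square^3),\phi(\square^4))$ with $\square=\square_{ij}$. Vector fields $v$ on $Y$ are vertical (identified with real-valued functions on the fibers $Y_{ij}$), and $j^2v(y_{ij},y_{i+1j},y_{i+1j+1},y_{ij+1})=(v(y_{ij}),v(y_{i+1j}),v(y_{i+1j+1}),v(y_{ij+1}))$ is the induced vector field on $\mathcal{B}$. $T_\phi\mathcal{C}_U$ consists of $V:U\to TY$ over $\phi$, identified with real-valued functions on $U$. A discrete Lagrangian is a function $L:\mathcal{B}\to\mathbb{R}$. The discrete Euler-Lagrange equations are: for all $(i,j)\in\mathrm{int}\,U$, $$\sum_{l;\square;(i,j)=\square^l}\frac{\partial L}{\partial y_l}(\phi(\square^1),\phi(\square^2),\phi(\square^3),\phi(\square^4))=0 .$$ (The possible dependence of $L$ on $\square$ is suppressed in the notation.) A first-variation equation solution at a solution $\phi$ is $V\in T_\phi\mathcal{C}_U$ such that for each $(i,j)\in\mathrm{int}\,U$, $$\sum_{l;\square;(i,j)=\square^l}\ \sum_{k=1}^4\frac{\partial^2L}{\partial y_k\partial y_l}(\phi(\square^1),\dots,\phi(\square^4))\,V(\square^k)=0 .$$ For $l=1,2,3,4$, $\Theta_L^l=\frac{\partial L}{\partial y_l}dy_l$ (no sum) are 1-forms on $\mathcal{B}$ and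 $\Omega_L^l=d\Theta_L^l=\sum_{k=1}^4\frac{\partial^2L}{\partial y_k\partial y_l}\,dy_k\wedge dy_l$. The notation $[(j^2\phi)^*f](\square^1)$ means $f$ evaluated at $j^2\phi(\square^1)$, and $\mathbf{i}$ is the interior product. The inner sum runs over all pairs $(\square,l)$ with $\square\subseteq U$ and $\square^l=(i,j)$. *)

theory Defs
  imports "HOL-Analysis.Analysis"
begin

type_synonym point = "int \<times> int"

text \<open>
  A rectangle is stored as its ordered 4-tuple of vertices, so \<open>\<box> $ l\<close> is the \<open>l\<close>-th
  vertex. The index type \<open>4\<close> has the elements \<open>1, 2, 3, 4\<close> (with \<open>4 = 0\<close>).
\<close>

type_synonym rectangle = "point ^ 4"

definition rect :: "point \<Rightarrow> rectangle" where
  "rect = (\<lambda>(i, j). vector [(i, j), (i + 1, j), (i + 1, j + 1), (i, j + 1)])"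

definition rectangles :: "rectangle set" where
  "rectangles = range rect"

definition vertices :: "rectangle \<Rightarrow> point set" where
  "vertices sq = range (\<lambda>l. sq $ l)"

definition touching :: "point \<Rightarrow> rectangle set" where
  "touching p = {sq \<in> rectangles. p \<in> vertices sq}"

definition lattice_interior :: "point set \<Rightarrow> point set" where
  "lattice_interior U = {p. \<forall>sq \<in> touching p. vertices sq \<subseteq> U}"

definition lattice_closure :: "point set \<Rightarrow> point set" where
  "lattice_closure U = (\<Union>p \<in> lattice_interior U. \<Union>sq \<in> touching p. vertices sq)"

definition lattice_boundary :: "point set \<Rightarrow> point set" where
  "lattice_boundary U = (U \<inter> lattice_closure U) - lattice_interior U"

definition regular :: "point set \<Rightarrow> bool" where
  "regular U \<longleftrightarrow> U = lattice_interior U \<union> lattice_boundary U"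

text \<open>
  The pairs \<open>(\<box>, l)\<close> with \<open>p = \<box>\<^sup>l\<close>. There are exactly four of them, so sums over this set
  are genuine finite sums.
\<close>

definition corners :: "point \<Rightarrow> (rectangle \<times> 4) set" where
  "corners p = {(sq, l). sq \<in> rectangles \<and> p = sq $ l}"

lemma rect_nth:
  "rect (i, j) $ 1 = (i, j)" "rect (i, j) $ 2 = (i + 1, j)"
  "rect (i, j) $ 3 = (i + 1, j + 1)" "rect (i, j) $ 4 = (i, j + 1)"
  by (simp_all add: rect_def vector_def)

lemma corners_eq:
  "corners (i, j) =
    {(rect (i, j), 1), (rect (i - 1, j), 2), (rect (i - 1, j - 1), 3), (rect (i, j - 1), 4)}"
proof (intro set_eqI iffI)
  fix x assume "x \<in> corners (i, j)"
  then obtain a b l where x: "x = (rect (a, b), l)" and l: "(i, j) = rect (a, b) $ l"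
    by (auto simp: corners_def rectangles_def)
  from exhaust_4[of l] l show "x \<in> {(rect (i, j), 1), (rect (i - 1, j), 2),
      (rect (i - 1, j - 1), 3), (rect (i, j - 1), 4)}"
    unfolding x by (elim disjE) (simp_all add: rect_nth)
qed (auto simp: corners_def rectangles_def rect_nth)

lemma finite_corners: "finite (corners p)"
  by (cases p) (simp add: corners_eq)

type_synonym Y = "point \<times> real"

text \<open>
  \<open>\<C>\<^sub>U\<close>: the sections of \<open>Y\<close> over \<open>U\<close>, as functions with the default value outside \<open>U\<close>.
\<close>

definition sections :: "point set \<Rightarrow> (point \<Rightarrow> Y) set" where
  "sections U = {\<phi> \<in> extensional U. \<forall>p \<in> U. fst (\<phi> p) = p}"

text \<open>
  \<open>T\<^sub>\<phi> \<C>\<^sub>U\<close>, identified for every \<open>\<phi>\<close> with the real-valued functions on \<open>U\<close>.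
\<close>

definition tangent_space :: "point set \<Rightarrow> (point \<Rightarrow> real) set" where
  "tangent_space U = extensional U"

text \<open>
  \<open>\<B> = X\<^sup>\<box> \<times> \<real>\<^sup>4\<close> is \<open>rectangles \<times> UNIV\<close> inside the following type; every condition below
  refers to points over members of \<open>rectangles\<close> only.
\<close>

type_synonym jet = "rectangle \<times> (real ^ 4)"

definition jet_on :: "(point \<Rightarrow> Y) \<Rightarrow> rectangle \<Rightarrow> jet" where
  "jet_on \<phi> sq = (sq, \<chi> l. snd (\<phi> (sq $ l)))"

definition j2 :: "(point \<Rightarrow> Y) \<Rightarrow> point \<Rightarrow> jet" where
  "j2 \<phi> p = jet_on \<phi> (rect p)"

text \<open>
  Vertical vector fields on \<open>Y\<close> are real-valued functions on \<open>Y\<close>. The tangent spaces of the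
  fibers of \<open>\<B>\<close> are identified with \<open>\<real>\<^sup>4\<close>.
\<close>

definition j2_field :: "(Y \<Rightarrow> real) \<Rightarrow> jet \<Rightarrow> real ^ 4" where
  "j2_field v = (\<lambda>(sq, y). \<chi> l. v (sq $ l, y $ l))"

definition partial :: "4 \<Rightarrow> (jet \<Rightarrow> real) \<Rightarrow> jet \<Rightarrow> real" where
  "partial l f = (\<lambda>(sq, y). deriv (\<lambda>t. f (sq, y + t *\<^sub>R axis l 1)) 0)"

primrec n_smooth :: "nat \<Rightarrow> (real ^ 4 \<Rightarrow> real) \<Rightarrow> bool" where
  "n_smooth 0 f \<longleftrightarrow> continuous_on UNIV f"
| "n_smooth (Suc n) f \<longleftrightarrow>
    (\<forall>y. f differentiable (at y)) \<and> (\<forall>u. n_smooth n (\<lambda>y. frechet_derivative f (at y) u))"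

definition smooth_lagrangian :: "(jet \<Rightarrow> real) \<Rightarrow> bool" where
  "smooth_lagrangian L \<longleftrightarrow> (\<forall>sq \<in> rectangles. \<forall>n. n_smooth n (\<lambda>y. L (sq, y)))"

text \<open>
  Since \<open>X\<^sup>\<box>\<close> is discrete, differential forms on \<open>\<B>\<close> only involve the fiber directions.
\<close>

type_synonym one_form = "jet \<Rightarrow> real ^ 4 \<Rightarrow> real"
type_synonym two_form = "jet \<Rightarrow> real ^ 4 \<Rightarrow> real ^ 4 \<Rightarrow> real"

definition dy :: "4 \<Rightarrow> one_form" where
  "dy l b u = u $ l"

definition wedge :: "one_form \<Rightarrow> one_form \<Rightarrow> two_form" where
  "wedge \<alpha> \<beta> b u w = \<alpha> b u * \<beta> b w - \<alpha> b w * \<beta> b u"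

text \<open>
  \<open>(d\<theta>)(u, w) = D\<^sub>u(\<theta>(w)) - D\<^sub>w(\<theta>(u))\<close> for constant fields \<open>u\<close>, \<open>w\<close>.
\<close>

definition ext_deriv :: "one_form \<Rightarrow> two_form" where
  "ext_deriv \<theta> = (\<lambda>(sq, y) u w.
     frechet_derivative (\<lambda>z. \<theta> (sq, z) w) (at y) u
   - frechet_derivative (\<lambda>z. \<theta> (sq, z) u) (at y) w)"

text \<open>
  The interior product, for forms of any positive degree.
\<close>

definition int_prod :: "(jet \<Rightarrow> real ^ 4) \<Rightarrow> (jet \<Rightarrow> real ^ 4 \<Rightarrow> 'a) \<Rightarrow> jet \<Rightarrow> 'a" where
  "int_prod \<xi> \<omega> b = \<omega> b (\<xi> b)"

definition Theta :: "(jet \<Rightarrow> real) \<Rightarrow> 4 \<Rightarrow> one_form" where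
  "Theta L l b u = partial l L b * dy l b u"

definition Omega :: "(jet \<Rightarrow> real) \<Rightarrow> 4 \<Rightarrow> two_form" where
  "Omega L l = ext_deriv (Theta L l)"

lemma partial_eq_frechet:
  assumes "(\<lambda>z. f (sq, z)) differentiable (at y)"
  shows "partial l f (sq, y) = frechet_derivative (\<lambda>z. f (sq, z)) (at y) (axis l 1)"
proof -
  let ?D = "frechet_derivative (\<lambda>z. f (sq, z)) (at y)"
  have D: "((\<lambda>z. f (sq, z)) has_derivative ?D) (at y)"
    using assms frechet_derivative_works by blast
  have "((\<lambda>t. y + t *\<^sub>R axis l 1) has_derivative (\<lambda>t. t *\<^sub>R axis l 1)) (at (0 :: real))"
    by (auto intro!: derivative_eq_intros)
  from diff_chain_at[OF this, of "\<lambda>z. f (sq, z)" ?D] D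
  have "((\<lambda>t. f (sq, y + t *\<^sub>R axis l 1)) has_derivative (\<lambda>t. ?D (t *\<^sub>R axis l 1))) (at 0)"
    by (simp add: o_def)
  moreover have "(\<lambda>t. ?D (t *\<^sub>R axis l 1)) = (*) (?D (axis l 1))"
    using has_derivative_linear[OF D] by (auto simp: linear_cmul)
  ultimately show ?thesis
    by (simp add: partial_def has_field_derivative_def DERIV_imp_deriv)
qed

lemma Omega_eq:
  assumes L: "smooth_lagrangian L" and sq: "sq \<in> rectangles"
  shows "Omega L l (sq, y) u w =
    (\<Sum>k \<in> UNIV. partial k (partial l L) (sq, y) * wedge (dy k) (dy l) (sq, y) u w)"
proof -
  have smooth: "n_smooth (Suc (Suc 0)) (\<lambda>z. L (sq, z))"
    using L sq unfolding smooth_lagrangian_def by blast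
  have eq: "(\<lambda>z. partial l L (sq, z)) =
      (\<lambda>z. frechet_derivative (\<lambda>z. L (sq, z)) (at z) (axis l 1))"
    using smooth by (auto intro!: ext partial_eq_frechet)
  have diff: "(\<lambda>z. partial l L (sq, z)) differentiable (at y)"
    using smooth unfolding eq by auto
  let ?D = "frechet_derivative (\<lambda>z. partial l L (sq, z)) (at y)"
  have D: "((\<lambda>z. partial l L (sq, z)) has_derivative ?D) (at y)"
    using diff frechet_derivative_works by blast
  have Dmult: "frechet_derivative (\<lambda>z. partial l L (sq, z) * c) (at y) = (\<lambda>u. ?D u * c)" for c
    using has_derivative_mult_left[OF D, of c] by (rule frechet_derivative_at[symmetric])
  have Du: "?D u = (\<Sum>k \<in> UNIV. partial k (partial l L) (sq, y) * u $ k)" for u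
  proof -
    have "?D u = ?D (\<Sum>k \<in> UNIV. (u $ k) *\<^sub>R axis k 1)"
      using basis_expansion[of u] by (simp add: scalar_mult_eq_scaleR)
    also have "\<dots> = (\<Sum>k \<in> UNIV. (u $ k) *\<^sub>R ?D (axis k 1))"
      using has_derivative_linear[OF D] by (simp add: linear_sum linear_cmul)
    finally show ?thesis
      using partial_eq_frechet[OF diff] by (simp add: mult.commute)
  qed
  show ?thesis
    unfolding Omega_def ext_deriv_def Theta_def dy_def wedge_def case_prod_conv Dmult Du
      sum_distrib_right
    by (simp add: sum_subtractf right_diff_distrib mult_ac)
qed

definition euler_lagrange_solution ::
    "(jet \<Rightarrow> real) \<Rightarrow> point set \<Rightarrow> (point \<Rightarrow> Y) \<Rightarrow> bool" where
  "euler_lagrange_solution L U \<phi> \<longleftrightarrow>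
    \<phi> \<in> sections U \<and>
    (\<forall>p \<in> lattice_interior U. (\<Sum>(sq, l) \<in> corners p. partial l L (jet_on \<phi> sq)) = 0)"

definition first_variation_solution ::
    "(jet \<Rightarrow> real) \<Rightarrow> point set \<Rightarrow> (point \<Rightarrow> Y) \<Rightarrow> (point \<Rightarrow> real) \<Rightarrow> bool" where
  "first_variation_solution L U \<phi> V \<longleftrightarrow>
    V \<in> tangent_space U \<and>
    (\<forall>p \<in> lattice_interior U.
      (\<Sum>(sq, l) \<in> corners p.
        \<Sum>k \<in> UNIV. partial k (partial l L) (jet_on \<phi> sq) * V (sq $ k)) = 0)"

end

theory Submission
  imports Defs
begin

text \<open>
  Summed over the four vertex labels, the forms add up to
  \<open>\<Sum>\<^sub>l \<Omega>\<^sub>L\<^sup>l = d (\<Sum>\<^sub>l \<Theta>\<^sub>L\<^sup>l) = d d L = 0\<close>; here this is the symmetry of the second partial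
  derivatives of \<open>L\<close> (\<open>mixed_derivatives_commute\<close>, \<open>sum_Omega_eq_0\<close>). Sum
  \<open>\<Omega>\<^sub>L\<^sup>l(j\<^sup>2v, j\<^sup>2w)\<close> over all rectangles inside \<open>U\<close> and all their labels: rectangle by
  rectangle, the result is \<open>0\<close>. Sorting the same terms by the vertex \<open>\<box>\<^sup>l \<in> U\<close> instead
  (\<open>sum_corners\<close>) splits the sum into the contributions of the interior points and those of the
  boundary points, because \<open>U\<close> is regular. At an interior point \<open>p\<close> all four rectangles
  touching \<open>p\<close> lie in \<open>U\<close>, and, with \<open>V = v \<circ> \<phi>\<close> and \<open>W = w \<circ> \<phi>\<close>, the contribution is \<open>W p\<close> times the first-variation equation
  of \<open>V\<close> at \<open>p\<close> minus \<open>V p\<close> times that of \<open>W\<close> (\<open>Omega_apply\<close>), hence \<open>0\<close>. What remains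
  is the boundary sum.
\<close>

section \<open>Symmetry of mixed directional derivatives\<close>

text \<open>
  Two applications of the mean value theorem, first to \<open>s \<mapsto> f (y + s u + h v) - f (y + s u)\<close> and
  then to \<open>t \<mapsto> Du (y + s u + t v)\<close>. The second difference on the left is symmetric in \<open>u\<close> and
  \<open>v\<close>, while the derivative on the right is taken along \<open>u\<close> first: this is what makes the two
  orders of differentiation comparable.
\<close>

lemma second_difference_mean_value:
  fixes f Du Dvu :: "'a :: real_vector \<Rightarrow> real"
  assumes Du: "\<And>z. ((\<lambda>t. f (z + t *\<^sub>R u)) has_real_derivative Du z) (at 0)"
    and Dvu: "\<And>z. ((\<lambda>t. Du (z + t *\<^sub>R v)) has_real_derivative Dvu z) (at 0)"
    and h: "h > 0"
  obtains s t where "0 < s" "s < h" "0 < t" "t < h"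
    "f (y + h *\<^sub>R u + h *\<^sub>R v) - f (y + h *\<^sub>R u) - f (y + h *\<^sub>R v) + f y
      = h * h * Dvu (y + s *\<^sub>R u + t *\<^sub>R v)"
proof -
  have line: "((\<lambda>t. g (z + t *\<^sub>R a)) has_real_derivative Dg (z + r *\<^sub>R a)) (at r)"
    if "\<And>z. ((\<lambda>t. g (z + t *\<^sub>R a)) has_real_derivative Dg z) (at 0)"
    for g Dg :: "'a \<Rightarrow> real" and a z r
  proof -
    have "((\<lambda>t. g (z + (t + r) *\<^sub>R a)) has_real_derivative Dg (z + r *\<^sub>R a)) (at 0)"
      using that[of "z + r *\<^sub>R a"] by (simp add: algebra_simps)
    then show ?thesis
      using DERIV_shift[of "\<lambda>t. g (z + t *\<^sub>R a)" _ 0 r] by simp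
  qed
  let ?g = "\<lambda>s. f ((y + h *\<^sub>R v) + s *\<^sub>R u) - f (y + s *\<^sub>R u)"
  have "(?g has_real_derivative Du ((y + h *\<^sub>R v) + s *\<^sub>R u) - Du (y + s *\<^sub>R u)) (at s)" for s
    using DERIV_diff[OF line[where g = f, OF Du, of "y + h *\<^sub>R v" s]
        line[where g = f, OF Du, of y s]] .
  from MVT2[OF h this] obtain s where s: "0 < s" "s < h"
    "?g h - ?g 0 = h * (Du ((y + h *\<^sub>R v) + s *\<^sub>R u) - Du (y + s *\<^sub>R u))"
    by auto
  have "((\<lambda>t. Du (y + s *\<^sub>R u + t *\<^sub>R v)) has_real_derivative Dvu (y + s *\<^sub>R u + t *\<^sub>R v)) (at t)"
    for t
    using line[where g = Du, OF Dvu, of "y + s *\<^sub>R u" t] .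
  from MVT2[OF h this] obtain t where t: "0 < t" "t < h"
    "Du (y + s *\<^sub>R u + h *\<^sub>R v) - Du (y + s *\<^sub>R u) = h * Dvu (y + s *\<^sub>R u + t *\<^sub>R v)"
    by auto
  have "f (y + h *\<^sub>R u + h *\<^sub>R v) - f (y + h *\<^sub>R u) - f (y + h *\<^sub>R v) + f y
      = h * h * Dvu (y + s *\<^sub>R u + t *\<^sub>R v)"
    using s(3) t(3) by (simp add: add_ac)
  with s t show thesis
    using that by blast
qed

text \<open>
  Schwarz's theorem: on a square of side \<open>h\<close> the second difference quotient is a value of each
  of the two mixed derivatives, and by continuity both values tend to those at \<open>y\<close> as
  \<open>h \<rightarrow> 0\<close>.
\<close>

lemma mixed_derivatives_commute:
  fixes f Du Dv Dvu Duv :: "'a :: real_normed_vector \<Rightarrow> real"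
  assumes Du: "\<And>z. ((\<lambda>t. f (z + t *\<^sub>R u)) has_real_derivative Du z) (at 0)"
    and Dv: "\<And>z. ((\<lambda>t. f (z + t *\<^sub>R v)) has_real_derivative Dv z) (at 0)"
    and Dvu: "\<And>z. ((\<lambda>t. Du (z + t *\<^sub>R v)) has_real_derivative Dvu z) (at 0)"
    and Duv: "\<And>z. ((\<lambda>t. Dv (z + t *\<^sub>R u)) has_real_derivative Duv z) (at 0)"
    and cont: "isCont Dvu y" "isCont Duv y"
  shows "Dvu y = Duv y"
proof -
  define h :: "nat \<Rightarrow> real" where "h n = inverse (real (Suc n))" for n
  have h_pos: "h n > 0" for n
    by (simp add: h_def)
  have h_lim: "h \<longlonglongrightarrow> 0"
    unfolding h_def by (rule LIMSEQ_inverse_real_of_nat)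
  have "\<exists>s t s' t'. 0 < s \<and> s < h n \<and> 0 < t \<and> t < h n \<and> 0 < s' \<and> s' < h n \<and> 0 < t' \<and> t' < h n \<and>
      Dvu (y + s *\<^sub>R u + t *\<^sub>R v) = Duv (y + s' *\<^sub>R v + t' *\<^sub>R u)" for n
  proof -
    from second_difference_mean_value[OF Du Dvu h_pos[of n], where y = y] obtain s t where
      st: "0 < s" "s < h n" "0 < t" "t < h n"
      "f (y + h n *\<^sub>R u + h n *\<^sub>R v) - f (y + h n *\<^sub>R u) - f (y + h n *\<^sub>R v) + f y
        = h n * h n * Dvu (y + s *\<^sub>R u + t *\<^sub>R v)" .
    from second_difference_mean_value[OF Dv Duv h_pos[of n], where y = y] obtain s' t' where
      st': "0 < s'" "s' < h n" "0 < t'" "t' < h n"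
      "f (y + h n *\<^sub>R v + h n *\<^sub>R u) - f (y + h n *\<^sub>R v) - f (y + h n *\<^sub>R u) + f y
        = h n * h n * Duv (y + s' *\<^sub>R v + t' *\<^sub>R u)" .
    have swap: "y + h n *\<^sub>R v + h n *\<^sub>R u = y + h n *\<^sub>R u + h n *\<^sub>R v"
      by (simp add: add_ac)
    have "h n * h n * Dvu (y + s *\<^sub>R u + t *\<^sub>R v) = h n * h n * Duv (y + s' *\<^sub>R v + t' *\<^sub>R u)"
      unfolding st(5)[symmetric] st'(5)[symmetric] swap by simp
    then have "Dvu (y + s *\<^sub>R u + t *\<^sub>R v) = Duv (y + s' *\<^sub>R v + t' *\<^sub>R u)"
      using h_pos[of n] by simp
    with st st' show ?thesis
      by blast
  qed
  then obtain s t s' t' where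
    bounds: "\<And>n. 0 < s n \<and> s n < h n" "\<And>n. 0 < t n \<and> t n < h n"
      "\<And>n. 0 < s' n \<and> s' n < h n" "\<And>n. 0 < t' n \<and> t' n < h n"
    and eq: "\<And>n. Dvu (y + s n *\<^sub>R u + t n *\<^sub>R v) = Duv (y + s' n *\<^sub>R v + t' n *\<^sub>R u)"
    by metis
  have squeeze: "r \<longlonglongrightarrow> 0" if "\<And>n. 0 < r n \<and> r n < h n" for r
    using that by (intro tendsto_sandwich[OF _ _ tendsto_const h_lim])
      (auto intro!: always_eventually less_imp_le)
  have point: "(\<lambda>n. y + p n *\<^sub>R a + q n *\<^sub>R b) \<longlonglongrightarrow> y"
    if "p \<longlonglongrightarrow> 0" "q \<longlonglongrightarrow> 0" for p q :: "nat \<Rightarrow> real" and a b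
  proof -
    have "(\<lambda>n. y + p n *\<^sub>R a + q n *\<^sub>R b) \<longlonglongrightarrow> y + 0 *\<^sub>R a + 0 *\<^sub>R b"
      using that by (intro tendsto_intros)
    then show ?thesis by simp
  qed
  have "(\<lambda>n. Dvu (y + s n *\<^sub>R u + t n *\<^sub>R v)) \<longlonglongrightarrow> Dvu y"
    by (intro isCont_tendsto_compose[OF cont(1)] point squeeze bounds)
  moreover have "(\<lambda>n. Duv (y + s' n *\<^sub>R v + t' n *\<^sub>R u)) \<longlonglongrightarrow> Duv y"
    by (intro isCont_tendsto_compose[OF cont(2)] point squeeze bounds)
  ultimately show ?thesis
    unfolding eq by (rule LIMSEQ_unique)
qed

section \<open>The fiberwise forms\<close>

lemma has_real_derivative_partial:
  assumes "(\<lambda>z. f (sq, z)) differentiable (at y)"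
  shows "((\<lambda>t. f (sq, y + t *\<^sub>R axis l 1)) has_real_derivative partial l f (sq, y)) (at 0)"
proof -
  have "(\<lambda>t. y + t *\<^sub>R axis l 1) differentiable (at (0 :: real))"
    by (intro derivative_intros)
  then have "((\<lambda>z. f (sq, z)) \<circ> (\<lambda>t. y + t *\<^sub>R axis l 1)) differentiable (at 0)"
    using assms by (intro differentiable_chain_at) simp_all
  then show ?thesis
    by (simp add: partial_def o_def DERIV_deriv_iff_real_differentiable)
qed

lemma n_smooth_partial:
  assumes "n_smooth (Suc n) (\<lambda>z. f (sq, z))"
  shows "n_smooth n (\<lambda>z. partial l f (sq, z))"
proof -
  have "(\<lambda>z. partial l f (sq, z)) =
      (\<lambda>z. frechet_derivative (\<lambda>z. f (sq, z)) (at z) (axis l 1))"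
    using assms by (auto intro!: ext partial_eq_frechet)
  then show ?thesis
    using assms by simp
qed

lemma partial_commute:
  assumes L: "smooth_lagrangian L" and sq: "sq \<in> rectangles"
  shows "partial k (partial l L) (sq, y) = partial l (partial k L) (sq, y)"
proof -
  have L2: "n_smooth (Suc (Suc 0)) (\<lambda>z. L (sq, z))"
    using L sq unfolding smooth_lagrangian_def by blast
  note L1 = n_smooth_partial[OF L2] and L0 = n_smooth_partial[OF n_smooth_partial[OF L2]]
  have first: "((\<lambda>t. L (sq, z + t *\<^sub>R axis m 1)) has_real_derivative partial m L (sq, z)) (at 0)"
    for m z
    using L2 by (intro has_real_derivative_partial) simp
  have second: "((\<lambda>t. partial m L (sq, z + t *\<^sub>R axis m' 1)) has_real_derivative
      partial m' (partial m L) (sq, z)) (at 0)" for m m' z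
    using L1 by (intro has_real_derivative_partial) simp
  have cont: "isCont (\<lambda>z. partial m (partial m' L) (sq, z)) y" for m m'
    using L0 by (simp add: continuous_on_eq_continuous_at)
  show ?thesis
    by (rule mixed_derivatives_commute[where f = "\<lambda>z. L (sq, z)"
          and u = "axis l 1" and Du = "\<lambda>z. partial l L (sq, z)"
          and Dvu = "\<lambda>z. partial k (partial l L) (sq, z)"
          and v = "axis k 1" and Dv = "\<lambda>z. partial k L (sq, z)"
          and Duv = "\<lambda>z. partial l (partial k L) (sq, z)",
          OF first first second second cont cont])
qed

text \<open>
  The part carrying \<open>w $ l\<close> is a term of the first-variation equation of \<open>u\<close> at the vertex
  \<open>\<box>\<^sup>l\<close>, and the part carrying \<open>u $ l\<close> one of that of \<open>w\<close>.
\<close>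

lemma Omega_apply:
  assumes "smooth_lagrangian L" and "sq \<in> rectangles"
  shows "Omega L l (sq, y) u w =
    w $ l * (\<Sum>k \<in> UNIV. partial k (partial l L) (sq, y) * u $ k)
    - u $ l * (\<Sum>k \<in> UNIV. partial k (partial l L) (sq, y) * w $ k)"
  unfolding Omega_eq[OF assms] wedge_def dy_def
  by (simp add: sum_distrib_left sum_subtractf[symmetric] algebra_simps)

lemma sum_Omega_eq_0:
  assumes "smooth_lagrangian L" and "sq \<in> rectangles"
  shows "(\<Sum>l \<in> UNIV. Omega L l (sq, y) u w) = 0"
proof -
  let ?a = "\<lambda>k l. partial k (partial l L) (sq, y)"
  have "(\<Sum>l \<in> UNIV. w $ l * (\<Sum>k \<in> UNIV. ?a k l * u $ k))
      = (\<Sum>l \<in> UNIV. \<Sum>k \<in> UNIV. w $ l * (?a k l * u $ k))"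
    by (simp add: sum_distrib_left)
  also have "\<dots> = (\<Sum>k \<in> UNIV. \<Sum>l \<in> UNIV. w $ l * (?a k l * u $ k))"
    by (rule sum.swap)
  also have "\<dots> = (\<Sum>k \<in> UNIV. \<Sum>l \<in> UNIV. u $ k * (?a l k * w $ l))"
    by (intro sum.cong refl) (simp add: partial_commute[OF assms] mult_ac)
  also have "\<dots> = (\<Sum>l \<in> UNIV. u $ l * (\<Sum>k \<in> UNIV. ?a k l * w $ k))"
    by (simp add: sum_distrib_left)
  finally show ?thesis
    unfolding Omega_apply[OF assms] sum_subtractf by simp
qed

section \<open>Rectangles and their corners\<close>

lemma rect_first_vertex: "sq \<in> rectangles \<Longrightarrow> rect (sq $ 1) = sq"
  by (auto simp: rectangles_def rect_nth)

lemma finite_rectangles_within: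
  assumes "finite U"
  shows "finite {sq \<in> rectangles. vertices sq \<subseteq> U}"
proof (rule finite_subset)
  show "{sq \<in> rectangles. vertices sq \<subseteq> U} \<subseteq> rect ` U"
  proof
    fix sq assume "sq \<in> {sq \<in> rectangles. vertices sq \<subseteq> U}"
    then have "sq = rect (sq $ 1)" "sq $ 1 \<in> U"
      by (auto simp: rect_first_vertex vertices_def)
    then show "sq \<in> rect ` U" by (rule image_eqI)
  qed
qed (use assms in simp)

lemma sum_corners:
  fixes g :: "rectangle \<times> 4 \<Rightarrow> 'a :: comm_monoid_add"
  assumes U: "finite U"
  shows "(\<Sum>p \<in> U. \<Sum>x \<in> {(sq, l) \<in> corners p. vertices sq \<subseteq> U}. g x)
    = (\<Sum>sq \<in> {sq \<in> rectangles. vertices sq \<subseteq> U}. \<Sum>l \<in> UNIV. g (sq, l))"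
proof -
  let ?S = "{sq \<in> rectangles. vertices sq \<subseteq> U} \<times> (UNIV :: 4 set)"
  have corners: "{(sq, l) \<in> corners p. vertices sq \<subseteq> U} = {x \<in> ?S. fst x $ snd x = p}" for p
    by (auto simp: corners_def)
  have "(\<Sum>p \<in> U. \<Sum>x \<in> {(sq, l) \<in> corners p. vertices sq \<subseteq> U}. g x) = sum g ?S"
    unfolding corners
    using U finite_rectangles_within[OF U] by (intro sum.group) (auto simp: vertices_def)
  then show ?thesis
    by (simp add: sum.cartesian_product)
qed

lemma corners_interior:
  assumes "p \<in> lattice_interior U"
  shows "{(sq, l) \<in> corners p. vertices sq \<subseteq> U} = corners p"
  using assms by (auto simp: lattice_interior_def touching_def corners_def vertices_def)

section \<open>The multisymplectic form formula\<close>

text \<open>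
  This is where \<open>\<phi>\<close> being a section enters: the vertical field \<open>j\<^sup>2v\<close> evaluates \<open>v\<close> at the
  vertex and height stored in the jet, and that point of \<open>Y\<close> is \<open>\<phi> (\<box>\<^sup>k)\<close> only if \<open>\<phi>\<close> maps
  \<open>\<box>\<^sup>k\<close> into the fiber over it.
\<close>

lemma j2_field_jet_on:
  assumes "\<phi> \<in> sections U" and "vertices sq \<subseteq> U"
  shows "j2_field v (jet_on \<phi> sq) $ k = restrict (v \<circ> \<phi>) U (sq $ k)"
proof -
  have "sq $ k \<in> U"
    using assms(2) by (auto simp: vertices_def)
  moreover from this have "(sq $ k, snd (\<phi> (sq $ k))) = \<phi> (sq $ k)"
    using assms(1) by (auto simp: sections_def prod_eq_iff)
  ultimately show ?thesis
    by (simp add: j2_field_def jet_on_def)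
qed

theorem mainTheorem5:
  fixes L :: "jet \<Rightarrow> real"
    and U :: "point set"
    and \<phi> :: "point \<Rightarrow> Y"
    and v w :: "Y \<Rightarrow> real"
  assumes "smooth_lagrangian L"
    and "finite U" and "regular U"
    and "euler_lagrange_solution L U \<phi>"
    and "first_variation_solution L U \<phi> (restrict (v \<circ> \<phi>) U)"
    and "first_variation_solution L U \<phi> (restrict (w \<circ> \<phi>) U)"
  shows "(\<Sum>p \<in> lattice_boundary U.
           \<Sum>(sq, l) \<in> {(sq, l) \<in> corners p. vertices sq \<subseteq> U}.
             (int_prod (j2_field w) (int_prod (j2_field v) (Omega L l)) \<circ> j2 \<phi>) (sq $ 1)) = 0"
proof -
  let ?V = "restrict (v \<circ> \<phi>) U" and ?W = "restrict (w \<circ> \<phi>) U"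
  let ?R = "{sq \<in> rectangles. vertices sq \<subseteq> U}"
  define F :: "rectangle \<times> 4 \<Rightarrow> real" where "F = (\<lambda>(sq, l).
    (int_prod (j2_field w) (int_prod (j2_field v) (Omega L l)) \<circ> j2 \<phi>) (sq $ 1))"
  define G where "G p = (\<Sum>x \<in> {(sq, l) \<in> corners p. vertices sq \<subseteq> U}. F x)" for p
  define E :: "(point \<Rightarrow> real) \<Rightarrow> rectangle \<times> 4 \<Rightarrow> real" where "E V = (\<lambda>(sq, l).
    \<Sum>k \<in> UNIV. partial k (partial l L) (jet_on \<phi> sq) * V (sq $ k))" for V
  have phi: "\<phi> \<in> sections U"
    using assms(4) by (simp add: euler_lagrange_solution_def)
  have F_Omega: "F (sq, l) =
      Omega L l (jet_on \<phi> sq) (j2_field v (jet_on \<phi> sq)) (j2_field w (jet_on \<phi> sq))"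
    if "sq \<in> rectangles" for sq l
    using that by (simp add: F_def int_prod_def j2_def rect_first_vertex)
  have F_E: "F (sq, l) = ?W (sq $ l) * E ?V (sq, l) - ?V (sq $ l) * E ?W (sq, l)"
    if "sq \<in> rectangles" "vertices sq \<subseteq> U" for sq l
    unfolding F_Omega[OF that(1)] E_def
    using Omega_apply[OF assms(1) that(1), of l "snd (jet_on \<phi> sq)"
        "j2_field v (jet_on \<phi> sq)" "j2_field w (jet_on \<phi> sq)"]
    unfolding j2_field_jet_on[OF phi that(2)]
    by (simp add: jet_on_def)

  have "sum G U = (\<Sum>sq \<in> ?R. \<Sum>l \<in> UNIV. F (sq, l))"
    unfolding G_def by (rule sum_corners[OF assms(2)])
  also have "\<dots> = 0"
  proof (rule sum.neutral, rule ballI)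
    fix sq assume "sq \<in> ?R"
    then have sq: "sq \<in> rectangles" by simp
    show "(\<Sum>l \<in> UNIV. F (sq, l)) = 0"
      unfolding F_Omega[OF sq] using sum_Omega_eq_0[OF assms(1) sq]
      by (simp add: jet_on_def)
  qed
  finally have total: "sum G U = 0" .

  have interior: "G p = 0" if p: "p \<in> lattice_interior U" for p
  proof -
    have "G p = (\<Sum>x \<in> corners p. ?W p * E ?V x - ?V p * E ?W x)"
      unfolding G_def corners_interior[OF p]
    proof (intro sum.cong refl)
      fix x assume x: "x \<in> corners p"
      then have "x \<in> {(sq, l) \<in> corners p. vertices sq \<subseteq> U}"
        unfolding corners_interior[OF p] .
      with x show "F x = ?W p * E ?V x - ?V p * E ?W x"
        using F_E by (cases x) (simp add: corners_def)
    qed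
    also have "\<dots> = ?W p * sum (E ?V) (corners p) - ?V p * sum (E ?W) (corners p)"
      by (simp add: sum_subtractf sum_distrib_left)
    also have "\<dots> = 0"
      using assms(5,6) p by (simp add: first_variation_solution_def E_def)
    finally show ?thesis .
  qed

  have "sum G U = sum G (lattice_interior U) + sum G (lattice_boundary U)"
  proof -
    have U: "U = lattice_interior U \<union> lattice_boundary U"
      using assms(3) by (simp add: regular_def)
    then have "finite (lattice_interior U)" "finite (lattice_boundary U)"
      using assms(2) by (metis finite_Un)+
    moreover have "lattice_interior U \<inter> lattice_boundary U = {}"
      by (auto simp: lattice_boundary_def)
    ultimately show ?thesis
      using sum.union_disjoint[of "lattice_interior U" "lattice_boundary U" G]
      unfolding U[symmetric] by blast
  qed
  with total interior have "sum G (lattice_boundary U) = 0"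
    by simp
  then show ?thesis
    by (simp add: G_def F_def)
qed

end
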